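(* Let $X$ be an i.i.d. source with alphabet $\mathcal{X}$ and entropy $H(X)$, and let $0\le L\le 1$. For each $n$ let $\mathcal{S}_n$ be a source code with encoder $s_n:\mathcal{X}^n\to\mathbb{F}_q^{m_n}$ and decoder $r_n:\mathbb{F}_q^{m_n}\to\mathcal{X}^n$. Let $k_n=nL_n\log|\mathcal{X}|/\log q$ be an integer, where $0\le L_n\le 1$ and $L_n\to L$ as $n\to\infty$, and let $\mathbf{H}_n$ be an $(m_n-k_n)\times m_n$ parity check matrix of an $(m_n,k_n,d)$ linear code over $\mathbb{F}_q$. If $\mathcal{S}_n$ is asymptotically optimal for the source $X$, i.e. $m_n/n\to H(X)/\log q$, then the syndrome scheme built from $(s_n,r_n,\mathbf{H}_n)$ (described in the context) achieves the optimal list-source tradeoff point $R(L)$ for the i.i.d. source $X$, where $R(\cdot)$ is the rate list function of $X$.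
   Context: Logarithms and entropies are in base 2, and $X^n=(X_1,\dots,X_n)$ is a vector of i.i.d. copies of $X$. An $(m,k,d)$ linear code over $\mathbb{F}_q$ (the field with $q$ elements) has length $m$, dimension $k$ and minimum distance $d$; $\mathbf{H}$ is a parity check matrix of it if $\mathbf{c}$ is a codeword exactly when $\mathbf{H}\mathbf{c}=0$. Syndrome scheme. Encoding: let $X^n$ be the sequence generated by the source. Compute the syndrome $S^{m_n-k_n}=\mathbf{H}_n s_n(X^n)$ and map each syndrome to a distinct sequence $Y^{nR}$ of $nR=\lceil (m_n-k_n)\log q\rceil$ bits. Decoding: map the binary codeword $Y^{nR}$ to the corresponding syndrome $S^{m_n-k_n}$, and output $r_n(x^{m_n})$ for each $x^{m_n}\in\mathbb{F}_q^{m_n}$ in the coset corresponding to that syndrome, i.e. each $x^{m_n}$ with $\mathbf{H}_n x^{m_n}=S^{m_n-k_n}$. List-source codes. A $(2^{nR},|\mathcal{X}|^{nL},n)$-list-source code for $X$ consists of an encoding function $f_n:\mathcal{X}^n\to\{1,\dots,2^{nR}\}$ and a list-decoding function $g_n:\{1,\dots,2^{nR}\}\to\mathcal{P}(\mathcal{X}^n)\setminus\{\varnothing\}$, where $\mathcal{P}(\mathcal{X}^n)$ is the power set of $\mathcal{X}^n$ and $|g_n(w)|=|\mathcal{X}|^{nL}$ for all $w$. Here $R$ is the rate and $L$ the normalized list size. The error probability is $e_L(f_n,g_n)=\Pr(X^n\notin g_n(f_n(X^n)))$. Rate list function. A pair $(R,L)$ is achievable if for every $\delta>0$, $0<\epsilon<1$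 and sufficiently large $n$ there exists a sequence of $(2^{nR'_n},|\mathcal{X}|^{nL'_n},n)$-list-source codes $(f_n,g_n)$ such that $R'_n<R+\delta$, $|L'_n-L|<\delta$ and $e_{L'_n}(f_n,g_n)\le\epsilon$. The rate list region is the closure of all achievable pairs $(R,L)$, and the rate list function $R(L)$ is the infimum of all rates $R$ such that $(R,L)$ is in the rate list region. Achieving the optimal tradeoff point $R(L)$ means achieving the pair $(R(L),L)$ in this sense with the codes given by the scheme.
   Formalization: Asymptotic optimality also requires Pr(r_n(s_n(X^n))≠X^n)→0 (constant encoders refute the claim otherwise); lists with fewer than |X|^{nL_n} sequences (r_n not injective on a coset, or unused bit strings) are filled up arbitrarily to that size. *)

theory Defs
  imports "HOL-Probability.Probability" "Jordan_Normal_Form.Matrix_Kernel"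
begin

text \<open>
  The source alphabet is the finite type \<open>'a\<close> and a memoryless source is given by the law
  \<open>p :: 'a pmf\<close> of one letter: \<open>replicate_pmf n p\<close> is the law of \<open>n\<close> i.i.d. copies, as a list of
  length \<open>n\<close>. The field with \<open>q\<close> elements is a finite type \<open>'f\<close> with \<open>CARD('f) = q\<close>.
\<close>

definition source_entropy :: "'a::finite pmf \<Rightarrow> real" where
  "source_entropy p = prob_space.entropy (measure_pmf p) 2 (count_space UNIV) (\<lambda>x. x)"

lemma source_entropy_eq:
  "source_entropy p = - (\<Sum>x\<in>UNIV. pmf p x * log 2 (pmf p x))"
proof -
  interpret information_space "measure_pmf p" 2
    by unfold_locales simp
  have "distributed (measure_pmf p) (count_space UNIV) (\<lambda>x. x) (\<lambda>x. ennreal (pmf p x))"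
    unfolding distributed_def by (auto simp: measure_pmf_eq_density[symmetric] distr_id2)
  then show ?thesis
    unfolding source_entropy_def
    by (subst entropy_distr) (auto simp: lebesgue_integral_count_space_finite)
qed


section \<open>List-source codes and the rate list function\<close>

text \<open>The conditions \<open>real M = 2 powr (n * R)\<close> and \<open>real (card (g w)) = \<dots>\<close> force
  \<open>2\<^sup>n\<^sup>R\<close> and \<open>|\<X>|\<^sup>n\<^sup>L\<close> to be integers.\<close>

definition list_source_code ::
    "real \<Rightarrow> real \<Rightarrow> nat \<Rightarrow> ('a::finite list \<Rightarrow> nat) \<Rightarrow> (nat \<Rightarrow> 'a list set) \<Rightarrow> bool" where
  "list_source_code R L n f g \<longleftrightarrow>
     (\<exists>M::nat. real M = 2 powr (real n * R) \<and>
        f \<in> {xs. length xs = n} \<rightarrow> {1..M} \<and>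
        g \<in> {1..M} \<rightarrow> Pow {xs. length xs = n} - {{}} \<and>
        (\<forall>w\<in>{1..M}. real (card (g w)) = real CARD('a) powr (real n * L)))"

definition list_error ::
    "'a::finite pmf \<Rightarrow> nat \<Rightarrow> ('a list \<Rightarrow> nat) \<Rightarrow> (nat \<Rightarrow> 'a list set) \<Rightarrow> real" where
  "list_error p n f g = measure_pmf.prob (replicate_pmf n p) {x. x \<notin> g (f x)}"

definition meets_tolerance ::
    "'a::finite pmf \<Rightarrow> real \<Rightarrow> real \<Rightarrow> real \<Rightarrow> real \<Rightarrow> nat \<Rightarrow> real \<Rightarrow> real \<Rightarrow>
      ('a list \<Rightarrow> nat) \<Rightarrow> (nat \<Rightarrow> 'a list set) \<Rightarrow> bool" where
  "meets_tolerance p R L \<delta> \<epsilon> n R' L' f g \<longleftrightarrow>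
     list_source_code R' L' n f g \<and> R' < R + \<delta> \<and> \<bar>L' - L\<bar> < \<delta> \<and> list_error p n f g \<le> \<epsilon>"

definition achievable :: "'a::finite pmf \<Rightarrow> real \<Rightarrow> real \<Rightarrow> bool" where
  "achievable p R L \<longleftrightarrow>
     (\<forall>\<delta>>0. \<forall>\<epsilon>. 0 < \<epsilon> \<and> \<epsilon> < 1 \<longrightarrow>
        (\<forall>\<^sub>F n in sequentially. \<exists>R' L' f g. meets_tolerance p R L \<delta> \<epsilon> n R' L' f g))"

text \<open>The pair \<open>(R, L)\<close> is achieved by one given sequence of codes \<open>(f n, g n)\<close>, with rates
  \<open>R' n\<close> and normalized list sizes \<open>L' n\<close>, simultaneously for all tolerances.\<close>

definition achieves ::
    "'a::finite pmf \<Rightarrow> (nat \<Rightarrow> real) \<Rightarrow> (nat \<Rightarrow> real) \<Rightarrow>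
      (nat \<Rightarrow> 'a list \<Rightarrow> nat) \<Rightarrow> (nat \<Rightarrow> nat \<Rightarrow> 'a list set) \<Rightarrow> real \<Rightarrow> real \<Rightarrow> bool" where
  "achieves p R' L' f g R L \<longleftrightarrow>
     (\<forall>\<delta>>0. \<forall>\<epsilon>. 0 < \<epsilon> \<and> \<epsilon> < 1 \<longrightarrow>
        (\<forall>\<^sub>F n in sequentially. meets_tolerance p R L \<delta> \<epsilon> n (R' n) (L' n) (f n) (g n)))"

definition rate_list_region :: "'a::finite pmf \<Rightarrow> (real \<times> real) set" where
  "rate_list_region p = closure {(R, L). achievable p R L}"

definition rate_list_function :: "'a::finite pmf \<Rightarrow> real \<Rightarrow> real" where
  "rate_list_function p L = Inf {R. (R, L) \<in> rate_list_region p}"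


section \<open>Source codes and linear codes\<close>

definition source_code ::
    "nat \<Rightarrow> nat \<Rightarrow> ('a list \<Rightarrow> 'f::{finite,field} vec) \<Rightarrow> ('f vec \<Rightarrow> 'a list) \<Rightarrow> bool" where
  "source_code n m s r \<longleftrightarrow>
     s \<in> {xs. length xs = n} \<rightarrow> carrier_vec m \<and> r \<in> carrier_vec m \<rightarrow> {xs. length xs = n}"

text \<open>Source codes are not assumed to be error free; asymptotic optimality means that the
  entropy rate is attained with vanishing error probability. Without the second condition a
  constant encoder would qualify.\<close>

definition asymptotically_optimal ::
    "'a::finite pmf \<Rightarrow> (nat \<Rightarrow> nat) \<Rightarrow> (nat \<Rightarrow> 'a list \<Rightarrow> 'f::{finite,field} vec) \<Rightarrow>
      (nat \<Rightarrow> 'f vec \<Rightarrow> 'a list) \<Rightarrow> bool" where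
  "asymptotically_optimal p m s r \<longleftrightarrow>
     (\<lambda>n. real (m n) / real n) \<longlonglongrightarrow> source_entropy p / log 2 (real CARD('f)) \<and>
     (\<lambda>n. measure_pmf.prob (replicate_pmf n p) {x. r n (s n x) \<noteq> x}) \<longlonglongrightarrow> 0"

definition hamming_dist :: "'f vec \<Rightarrow> 'f vec \<Rightarrow> nat" where
  "hamming_dist x y = card {i. i < dim_vec x \<and> vec_index x i \<noteq> vec_index y i}"

text \<open>The minimum distance of the zero code is a matter of convention and left open.\<close>

definition linear_code :: "nat \<Rightarrow> nat \<Rightarrow> nat \<Rightarrow> 'f::{finite,field} vec set \<Rightarrow> bool" where
  "linear_code m k d C \<longleftrightarrow>
     VectorSpace.subspace class_ring C (module_vec TYPE('f) m) \<and>
     vectorspace.dim class_ring ((module_vec TYPE('f) m)\<lparr>carrier := C\<rparr>) = k \<and>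
     (C \<noteq> {0\<^sub>v m} \<longrightarrow> d = Inf {hamming_dist x y |x y. x \<in> C \<and> y \<in> C \<and> x \<noteq> y})"

definition parity_check_matrix :: "'f::{finite,field} mat \<Rightarrow> 'f vec set \<Rightarrow> bool" where
  "parity_check_matrix H C \<longleftrightarrow>
     (\<forall>c\<in>carrier_vec (dim_col H). c \<in> C \<longleftrightarrow> H *\<^sub>v c = 0\<^sub>v (dim_row H))"


section \<open>The syndrome scheme\<close>

definition syndrome_bits :: "'f::{finite,field} itself \<Rightarrow> nat \<Rightarrow> nat" where
  "syndrome_bits _ l = nat \<lceil>real l * log 2 (real CARD('f))\<rceil>"

definition syndrome_labelling :: "nat \<Rightarrow> ('f::{finite,field} vec \<Rightarrow> bool list) \<Rightarrow> bool" where
  "syndrome_labelling l \<beta> \<longleftrightarrow>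
     \<beta> \<in> carrier_vec l \<rightarrow> {ys. length ys = syndrome_bits TYPE('f) l} \<and> inj_on \<beta> (carrier_vec l)"

text \<open>Numbering of the \<open>2\<^sup>b\<close> bit strings of length \<open>b\<close> by \<open>1, \<dots>, 2\<^sup>b\<close>.\<close>

definition word_index :: "bool list \<Rightarrow> nat" where
  "word_index ys = 1 + horner_sum of_bool 2 ys"

definition syndrome_encode ::
    "'f::{finite,field} mat \<Rightarrow> ('a list \<Rightarrow> 'f vec) \<Rightarrow> ('f vec \<Rightarrow> bool list) \<Rightarrow> 'a list \<Rightarrow> bool list" where
  "syndrome_encode H s \<beta> x = \<beta> (H *\<^sub>v s x)"

definition syndrome_decode ::
    "'f::{finite,field} mat \<Rightarrow> ('f vec \<Rightarrow> 'a list) \<Rightarrow> ('f vec \<Rightarrow> bool list) \<Rightarrow> bool list \<Rightarrow> 'a list set" where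
  "syndrome_decode H r \<beta> y =
     {r v |v. v \<in> carrier_vec (dim_col H) \<and> H *\<^sub>v v = inv_into (carrier_vec (dim_row H)) \<beta> y}"

text \<open>
  \<open>(f, g)\<close> is the scheme's code, presented as a list-source code. A coset has
  \<open>CARD('f) ^ k\<close> elements, which is therefore the list size. Two points are left open by the
  scheme and unconstrained here: \<open>g\<close> on bit strings that label no syndrome, and, where \<open>r\<close>
  maps several elements of a coset to the same sequence, the further sequences that fill
  the list up to the required size. If \<open>r\<close> is injective on a coset, the cardinality
  condition makes the list equal to the output of \<open>syndrome_decode\<close>.
\<close>

definition syndrome_scheme ::
    "nat \<Rightarrow> nat \<Rightarrow> 'f::{finite,field} mat \<Rightarrow> ('a list \<Rightarrow> 'f vec) \<Rightarrow> ('f vec \<Rightarrow> 'a list) \<Rightarrow>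
      ('f vec \<Rightarrow> bool list) \<Rightarrow> ('a list \<Rightarrow> nat) \<Rightarrow> (nat \<Rightarrow> 'a list set) \<Rightarrow> bool" where
  "syndrome_scheme n k H s r \<beta> f g \<longleftrightarrow>
     (\<forall>x. length x = n \<longrightarrow> f x = word_index (syndrome_encode H s \<beta> x)) \<and>
     (\<forall>y\<in>\<beta> ` carrier_vec (dim_row H). syndrome_decode H r \<beta> y \<subseteq> g (word_index y)) \<and>
     (\<forall>w\<in>{1..2 ^ syndrome_bits TYPE('f) (dim_row H)}.
        g w \<subseteq> {xs. length xs = n} \<and> card (g w) = CARD('f) ^ k)"

end

theory Submission
  imports Defs "Jordan_Normal_Form.DL_Rank"
begin

text \<open>
  The lists of a code at rate \<open>R'\<close> and list size \<open>|\<X>|\<^sup>n\<^sup>L\<close> contain at most \<open>2\<^sup>n\<^sup>c\<close> sequences in total,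
  where \<open>c = R' + L log |\<X>|\<close>. If \<open>c < H(X)\<close>, a set of that size has vanishing probability, so
  \<open>H(X) \<le> R + L log |\<X>|\<close> on the rate list region. The scheme attains equality:
  its lists contain \<open>X\<^sup>n\<close> whenever the source code decodes correctly, and its rate tends to
  \<open>lim (m\<^sub>n - k\<^sub>n) log q / n = H(X) - L log |\<X>|\<close>. Hence that point lies in the region, and
  \<open>R(L)\<close> is its first coordinate.
\<close>

section \<open>Sizes of cosets\<close>

lemma (in vectorspace) fin_dim_if_finite_carrier:
  assumes "finite (carrier V)"
  shows "fin_dim"
  unfolding fin_dim_def
  using assms in_own_span[of "carrier V"] span_is_subset2[of "carrier V"] by blast

text \<open>Coefficient functions on a basis map onto the space, and there are
  \<open>card (carrier K) ^ dim\<close> of them.\<close>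

lemma (in vectorspace) card_carrier_le:
  assumes finK: "finite (carrier K)" and fd: "fin_dim"
  shows "card (carrier V) \<le> card (carrier K) ^ dim"
proof -
  obtain B where B: "finite B" "basis B"
    using finite_basis_exists[OF fd] by blast
  then have BV: "B \<subseteq> carrier V" and gen: "span B = carrier V"
    by (auto simp: basis_def)
  have "carrier V \<subseteq> (\<lambda>a. lincomb a B) ` (B \<rightarrow>\<^sub>E carrier K)"
  proof
    fix v assume "v \<in> carrier V"
    then obtain a where a: "a \<in> B \<rightarrow> carrier K" "v = lincomb a B"
      using finite_span[OF B(1) BV] gen by auto
    \<comment> \<open>Fixing the values outside \<open>B\<close> leaves only the functions in the
      finite set \<open>B \<rightarrow>\<^sub>E carrier K\<close> to count.\<close>
    moreover have "lincomb a B = lincomb (restrict a B) B"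
      by (rule lincomb_restrict[OF BV a(1)]) simp
    ultimately show "v \<in> (\<lambda>a. lincomb a B) ` (B \<rightarrow>\<^sub>E carrier K)"
      by (intro image_eqI[of _ _ "restrict a B"]) auto
  qed
  then have "card (carrier V) \<le> card (B \<rightarrow>\<^sub>E carrier K)"
    by (intro surj_card_le) (auto intro: finite_PiE B(1) finK)
  also have "\<dots> = card (carrier K) ^ dim"
    using dim_basis[OF B] by (simp add: card_PiE B(1))
  finally show ?thesis .
qed

lemma finite_carrier_vec_UNIV: "finite (carrier_vec n :: 'b::finite vec set)"
proof -
  have "carrier_vec n \<subseteq> vec_of_list ` {xs :: 'b list. set xs \<subseteq> UNIV \<and> length xs = n}"
    by (auto intro!: image_eqI[of _ _ "list_of_vec _"] simp: vec_list)
  then show ?thesis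
    by (rule finite_subset) (intro finite_imageI finite_lists_length_eq finite)
qed

lemma linear_code_subset:
  assumes "linear_code m k d C"
  shows "C \<subseteq> carrier_vec m"
  using assms by (auto simp: linear_code_def VectorSpace.subspace_def submodule_def module_vec_simps)

text \<open>The code is a vector space of its own inside one of dimension \<open>m\<close>. The
  bound \<open>k \<le> m\<close> makes the truncated difference \<open>m - k\<close> a true one when
  the rate is computed.\<close>

lemma
  fixes C :: "'f::{finite,field} vec set"
  assumes "linear_code m k d C"
  shows linear_code_card_le: "card C \<le> CARD('f) ^ k"
    and linear_code_dim_le: "k \<le> m"
proof -
  interpret V: vec_space "TYPE('f)" m .
  have sub: "VectorSpace.subspace class_ring C V.V" and dimC: "vectorspace.dim class_ring (V.vs C) = k"
    using assms by (auto simp: linear_code_def)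
  interpret W: vectorspace class_ring "V.vs C"
    by (rule V.subspace_is_vs[OF sub])
  have "finite C"
    using linear_code_subset[OF assms] finite_carrier_vec_UNIV finite_subset by blast
  then have fd: "W.fin_dim"
    by (intro W.fin_dim_if_finite_carrier) simp
  show "card C \<le> CARD('f) ^ k"
    using W.card_carrier_le[OF _ fd] dimC by simp
  show "k \<le> m"
    using V.subspace_dim[OF sub V.fin_dim fd] dimC V.dim_is_n by simp
qed

text \<open>Subtracting a fixed member maps a nonempty coset injectively into the code.\<close>

lemma syndrome_coset_card_le:
  fixes H :: "'f::{finite,field} mat"
  assumes H: "H \<in> carrier_mat l m" and "linear_code m k d C" and par: "parity_check_matrix H C"
  shows "card {v \<in> carrier_vec m. H *\<^sub>v v = w} \<le> CARD('f) ^ k"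
proof (cases "{v \<in> carrier_vec m. H *\<^sub>v v = w} = {}")
  case False
  then obtain u where u: "u \<in> carrier_vec m" "H *\<^sub>v u = w"
    by blast
  have C: "C \<subseteq> carrier_vec m"
    using linear_code_subset[OF assms(2)] .
  have "(\<lambda>v. v - u) ` {v \<in> carrier_vec m. H *\<^sub>v v = w} \<subseteq> C"
  proof safe
    fix v assume v: "v \<in> carrier_vec m" "w = H *\<^sub>v v"
    then have "H *\<^sub>v (v - u) = 0\<^sub>v (dim_row H)"
      using u H by (auto simp: mult_minus_distrib_mat_vec)
    then show "v - u \<in> C"
      using par v u H by (auto simp: parity_check_matrix_def)
  qed
  moreover have "inj_on (\<lambda>v. v - u) {v \<in> carrier_vec m. H *\<^sub>v v = w}"
  proof (rule inj_onI, safe)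
    fix x y assume "x \<in> carrier_vec m" "y \<in> carrier_vec m" "x - u = y - u"
    moreover have "v - u + u = v" if "v \<in> carrier_vec m" for v
      using that u by (intro eq_vecI) auto
    ultimately show "x = y"
      by metis
  qed
  moreover have "finite C"
    using C finite_carrier_vec_UNIV finite_subset by blast
  ultimately have "card {v \<in> carrier_vec m. H *\<^sub>v v = w} \<le> card C"
    by (intro card_inj_on_le) auto
  then show ?thesis
    using linear_code_card_le[OF assms(2)] by linarith
next
  case True
  show ?thesis
    unfolding True by simp
qed

section \<open>Syndrome labels\<close>

lemma word_index_le:
  assumes "length ys = b"
  shows "word_index ys \<in> {1..2 ^ b}"
  using horner_sum_of_bool_2_less[of ys, where ?'a = nat] assms
  by (auto simp: word_index_def)

text \<open>The parity of the number gives the first bit, and halving it gives the rest. Equal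
  lengths matter: trailing \<open>False\<close> bits do not change the number.\<close>

lemma word_index_inject:
  "length xs = length ys \<Longrightarrow> word_index xs = word_index ys \<longleftrightarrow> xs = ys"
proof (induction xs ys rule: list_induct2)
  case (Cons x xs y ys)
  have "word_index (x # xs) = word_index (y # ys) \<longleftrightarrow> x = y \<and> word_index xs = word_index ys"
    by (cases x; cases y; simp add: word_index_def; presburger)
  then show ?case
    using Cons by simp
qed simp

section \<open>The converse bound\<close>

lemma finite_length_eq: "finite {xs :: 'a::finite list. length xs = n}"
  using finite_lists_length_eq[of "UNIV :: 'a set" n] by simp

lemma pmf_replicate_pmf:
  "length xs = n \<Longrightarrow> pmf (replicate_pmf n p) xs = prod_list (map (pmf p) xs)"
proof (induction n arbitrary: xs)
  case (Suc n)
  then obtain y ys where xs: "xs = y # ys" "length ys = n"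
    by (auto simp: length_Suc_conv)
  have "replicate_pmf (Suc n) p = map_pmf (\<lambda>(x, xs). x # xs) (pair_pmf p (replicate_pmf n p))"
    by (simp add: pair_pmf_def map_bind_pmf)
  then have "pmf (replicate_pmf (Suc n) p) xs = pmf (pair_pmf p (replicate_pmf n p)) (y, ys)"
    using pmf_map_inj'[of "\<lambda>(x, xs). x # xs" "pair_pmf p (replicate_pmf n p)" "(y, ys)"]
    by (auto simp: xs inj_def)
  then show ?case
    using Suc xs by (simp add: pmf_pair)
qed simp

text \<open>Expanding the power yields one monomial per word; this lets moments of the product law
  factor over letters.\<close>

lemma sum_prod_list_length_eq:
  fixes h :: "'a::finite \<Rightarrow> real"
  shows "(\<Sum>xs | length xs = n. prod_list (map h xs)) = (\<Sum>x\<in>UNIV. h x) ^ n"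
proof (induction n)
  case (Suc n)
  have "{xs :: 'a list. length xs = Suc n} = (\<lambda>(x, xs). x # xs) ` (UNIV \<times> {xs. length xs = n})"
    by (auto simp: length_Suc_conv)
  moreover have "inj_on (\<lambda>(x, xs). x # xs) (UNIV \<times> {xs :: 'a list. length xs = n})"
    by (auto simp: inj_on_def)
  ultimately have "(\<Sum>xs | length xs = Suc n. prod_list (map h xs)) =
      (\<Sum>(x, xs)\<in>UNIV \<times> {xs. length xs = n}. h x * prod_list (map h xs))"
    by (simp add: sum.reindex case_prod_unfold)
  also have "\<dots> = (\<Sum>x\<in>UNIV. h x) * (\<Sum>xs | length xs = n. prod_list (map h xs))"
    by (simp add: sum_product sum.cartesian_product)
  finally show ?case
    using Suc by simp
qed simp

lemma prod_list_powr:
  "\<forall>x\<in>set xs. 0 \<le> h x \<Longrightarrow> prod_list (map h xs) powr c = prod_list (map (\<lambda>x. h x powr c) xs)"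
  for h :: "'a \<Rightarrow> real"
  by (induction xs) (auto simp: powr_mult prod_list_nonneg)

text \<open>Sequences more likely than \<open>\<theta>\<^sup>n\<close> are charged to the moment of order \<open>1 + t\<close>, as in Chernoff's
  bound, which factors over the letters.\<close>

lemma prob_replicate_pmf_le:
  fixes p :: "'a::finite pmf"
  assumes A: "A \<subseteq> {xs. length xs = n}" and "0 < \<theta>" "0 \<le> t"
  shows "measure_pmf.prob (replicate_pmf n p) A \<le>
    real (card A) * \<theta> ^ n + ((\<Sum>x\<in>UNIV. pmf p x powr (1 + t)) * \<theta> powr - t) ^ n"
proof -
  let ?P = "pmf (replicate_pmf n p)"
  have fin: "finite A"
    using A finite_length_eq finite_subset by blast
  \<comment> \<open>Below the threshold the first summand suffices. Above it, the ratio to the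
    threshold exceeds 1, so its power \<open>t\<close> can be multiplied in, which gives the second
    summand.\<close>
  have pt: "?P x \<le> \<theta> ^ n + ?P x powr (1 + t) * (\<theta> ^ n) powr - t" for x
  proof (cases "?P x \<le> \<theta> ^ n")
    case False
    then have "1 \<le> (?P x / \<theta> ^ n) powr t"
      using \<open>0 < \<theta>\<close> \<open>0 \<le> t\<close> by (intro ge_one_powr_ge_zero) auto
    then have "?P x * 1 \<le> ?P x * (?P x / \<theta> ^ n) powr t"
      by (intro mult_left_mono) auto
    also have "\<dots> = ?P x powr (1 + t) * (\<theta> ^ n) powr - t"
      using \<open>0 < \<theta>\<close> by (simp add: powr_add powr_divide powr_minus_divide)
    finally show ?thesis
      using \<open>0 < \<theta>\<close> by (simp add: add_increasing)
  qed (simp add: add_increasing2)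
  have "measure_pmf.prob (replicate_pmf n p) A = (\<Sum>x\<in>A. ?P x)"
    by (rule measure_measure_pmf_finite[OF fin])
  also have "\<dots> \<le> (\<Sum>x\<in>A. \<theta> ^ n + ?P x powr (1 + t) * (\<theta> ^ n) powr - t)"
    by (rule sum_mono[OF pt])
  also have "\<dots> = real (card A) * \<theta> ^ n + (\<Sum>x\<in>A. ?P x powr (1 + t)) * (\<theta> ^ n) powr - t"
    by (simp add: sum.distrib sum_distrib_right)
  \<comment> \<open>The moment is extended from \<open>A\<close> to all words of length
    \<open>n\<close>, where it factors.\<close>
  also have "(\<Sum>x\<in>A. ?P x powr (1 + t)) \<le> (\<Sum>x | length x = n. ?P x powr (1 + t))"
    by (rule sum_mono2[OF finite_length_eq A]) simp
  also have "\<dots> = (\<Sum>x | length x = n. prod_list (map (\<lambda>a. pmf p a powr (1 + t)) x))"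
    by (rule sum.cong) (auto simp: pmf_replicate_pmf prod_list_powr)
  also have "\<dots> = (\<Sum>a\<in>UNIV. pmf p a powr (1 + t)) ^ n"
    by (rule sum_prod_list_length_eq)
  also have "(\<theta> ^ n) powr - t = (\<theta> powr - t) ^ n"
    using \<open>0 < \<theta>\<close> by (simp add: powr_power powr_realpow[symmetric] powr_powr mult.commute)
  finally show ?thesis
    by (simp add: power_mult_distrib mult_right_mono)
qed

text \<open>As a function of \<open>t\<close> the product is 1 at 0 and has derivative
  \<open>(h - source_entropy p) * ln 2\<close> there, which is negative; so a small positive
  \<open>t\<close> works. With \<theta> = \<open>2 powr - h\<close>, the moment term of the
  preceding bound then decays exponentially.\<close>

lemma entropy_tilt_lt_1:
  fixes p :: "'a::finite pmf"
  assumes "h < source_entropy p"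
  shows "\<exists>t>0. (\<Sum>x\<in>UNIV. pmf p x powr (1 + t)) * (2 powr - h) powr - t < 1"
proof -
  define \<phi> where "\<phi> t = (\<Sum>x\<in>UNIV. pmf p x powr (1 + t)) * (2 powr - h) powr - t" for t
  \<comment> \<open>For a letter of probability zero both the function and the claimed derivative
    vanish, in line with the convention 0 log 0 = 0.\<close>
  have powr_deriv: "((\<lambda>t. pmf p x powr (1 + t)) has_real_derivative pmf p x * ln (pmf p x)) (at 0)" for x
  proof (cases "pmf p x = 0")
    case False
    then have "0 < pmf p x" by (simp add: less_le)
    then show ?thesis
      by (auto intro!: derivative_eq_intros)
  qed simp
  have "(\<phi> has_real_derivative
      (\<Sum>x\<in>UNIV. pmf p x powr (1 + 0)) * (h * ln 2) +
      (\<Sum>x\<in>UNIV. pmf p x * ln (pmf p x)) * (2 powr - h) powr - 0) (at 0)"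
    unfolding \<phi>_def
    by (rule DERIV_cong, rule DERIV_mult, rule DERIV_sum, rule powr_deriv)
      (auto intro!: derivative_eq_intros simp: ln_powr)
  moreover have "(\<Sum>x\<in>UNIV. pmf p x powr (1 + 0)) = 1"
    using sum_pmf_eq_1[of UNIV p] by simp
  moreover have "(\<Sum>x\<in>UNIV. pmf p x * ln (pmf p x)) = - source_entropy p * ln 2"
    by (simp add: source_entropy_eq log_def sum_divide_distrib[symmetric])
  ultimately have "(\<phi> has_real_derivative (h - source_entropy p) * ln 2) (at 0)"
    by (simp add: algebra_simps)
  moreover have "(h - source_entropy p) * ln 2 < 0"
    using assms by (simp add: mult_neg_pos)
  ultimately obtain e where "0 < e" "\<And>t. 0 < t \<Longrightarrow> t < e \<Longrightarrow> \<phi> (0 + t) < \<phi> 0"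
    using DERIV_neg_dec_right by blast
  then have "\<phi> (e / 2) < \<phi> 0" "0 < e / 2"
    by (metis add_0 half_gt_zero field_sum_of_halves less_add_same_cancel1)+
  moreover have "\<phi> 0 = 1"
    using sum_pmf_eq_1[of UNIV p] by (simp add: \<phi>_def)
  ultimately show ?thesis
    unfolding \<phi>_def by metis
qed

text \<open>A correctly listed word lies in the union of the \<open>M\<close> lists, all of the same
  size; writing that size as a power of 2 merges the two exponents.\<close>

lemma list_source_code_hit_card_le:
  fixes f :: "'a::finite list \<Rightarrow> nat"
  assumes "list_source_code R L n f g"
  shows "real (card {x. length x = n \<and> x \<in> g (f x)}) \<le>
    2 powr (real n * (R + L * log 2 (real CARD('a))))"
proof -
  obtain M where M: "real M = 2 powr (real n * R)" "f \<in> {xs. length xs = n} \<rightarrow> {1..M}"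
    and card_g: "\<And>w. w \<in> {1..M} \<Longrightarrow> real (card (g w)) = real CARD('a) powr (real n * L)"
    and g: "\<And>w. w \<in> {1..M} \<Longrightarrow> g w \<subseteq> {xs. length xs = n}"
    using assms by (fastforce simp: list_source_code_def)
  have "{x. length x = n \<and> x \<in> g (f x)} \<subseteq> (\<Union>w\<in>{1..M}. g w)"
    using M(2) by auto
  moreover have "finite (\<Union>w\<in>{1..M}. g w)"
    using g finite_length_eq finite_subset by (intro finite_UN_I) blast+
  ultimately have "card {x. length x = n \<and> x \<in> g (f x)} \<le> card (\<Union>w\<in>{1..M}. g w)"
    by (rule card_mono[rotated])
  also have "\<dots> \<le> (\<Sum>w\<in>{1..M}. card (g w))"
    by (rule card_UN_le) simp
  finally have "real (card {x. length x = n \<and> x \<in> g (f x)}) \<le> (\<Sum>w\<in>{1..M}. real (card (g w)))"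
    by (metis of_nat_le_iff of_nat_sum)
  also have "\<dots> = 2 powr (real n * R) * real CARD('a) powr (real n * L)"
    using card_g M(1) by simp
  also have "real CARD('a) powr (real n * L) = 2 powr (log 2 (real CARD('a)) * (real n * L))"
    by (simp add: powr_powr[symmetric])
  finally show ?thesis
    unfolding powr_add[symmetric] by (simp add: algebra_simps)
qed

text \<open>Otherwise the correctly listed words are too few to keep probability 1/2 for large
  \<open>n\<close>.\<close>

lemma achievable_imp_entropy_le:
  fixes p :: "'a::finite pmf"
  assumes "achievable p R L"
  shows "source_entropy p \<le> R + L * log 2 (real CARD('a))"
proof (rule ccontr)
  define \<kappa> where "\<kappa> = log 2 (real CARD('a))"
  assume "\<not> source_entropy p \<le> R + L * log 2 (real CARD('a))"
  then have gap: "R + L * \<kappa> < source_entropy p"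
    by (simp add: \<kappa>_def)
  \<comment> \<open>The gap is split in three: one third absorbs the tolerances, one drives the
    decay of count times threshold, and one keeps \<open>h\<close> below the entropy.\<close>
  define \<eta> where "\<eta> = (source_entropy p - (R + L * \<kappa>)) / 3"
  define h where "h = R + L * \<kappa> + 2 * \<eta>"
  have "0 < \<eta>" and "h < source_entropy p"
    using gap by (auto simp: \<eta>_def h_def field_simps)
  have "0 \<le> \<kappa>"
    by (simp add: \<kappa>_def Suc_leI)
  \<comment> \<open>Chosen so that the slack \<delta> in the rate and the slack \<delta> * \<kappa>
    from the list size add up to \<eta>.\<close>
  define \<delta> where "\<delta> = \<eta> / (1 + \<kappa>)"
  have "0 < \<delta>" and "\<delta> * (1 + \<kappa>) = \<eta>"
    using \<open>0 < \<eta>\<close> \<open>0 \<le> \<kappa>\<close> by (auto simp: \<delta>_def)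
  then have \<delta>: "\<delta> + \<delta> * \<kappa> = \<eta>"
    by (simp add: algebra_simps)
  obtain t where "0 < t" and tilt: "(\<Sum>x\<in>UNIV. pmf p x powr (1 + t)) * (2 powr - h) powr - t < 1"
    using entropy_tilt_lt_1[OF \<open>h < source_entropy p\<close>] by blast
  define \<rho> where "\<rho> = (\<Sum>x\<in>UNIV. pmf p x powr (1 + t)) * (2 powr - h) powr - t"
  have "0 \<le> \<rho>" "\<rho> < 1"
    using tilt by (auto simp: \<rho>_def intro!: sum_nonneg mult_nonneg_nonneg)
  have "(\<lambda>n. (2 powr - \<eta>) ^ n + \<rho> ^ n) \<longlonglongrightarrow> 0 + 0"
    using \<open>0 < \<eta>\<close> \<open>0 \<le> \<rho>\<close> \<open>\<rho> < 1\<close>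
    by (intro tendsto_add LIMSEQ_power_zero) (auto simp: powr_less_one)
  then have "\<forall>\<^sub>F n in sequentially. (2 powr - \<eta>) ^ n + \<rho> ^ n < 1 / 2"
    by (rule order_tendstoD) simp
  moreover have "\<forall>\<^sub>F n in sequentially. \<exists>R' L' f g. meets_tolerance p R L \<delta> (1 / 2) n R' L' f g"
    using assms \<open>0 < \<delta>\<close> unfolding achievable_def by simp
  ultimately have "\<forall>\<^sub>F n in sequentially. False"
  proof eventually_elim
    case (elim n)
    then obtain R' L' f g where code: "list_source_code R' L' n f g"
      and R': "R' < R + \<delta>" and L': "\<bar>L' - L\<bar> < \<delta>" and err: "list_error p n f g \<le> 1 / 2"
      unfolding meets_tolerance_def by blast
    define A where "A = {x. length x = n \<and> x \<in> g (f x)}"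
    have "1 = measure_pmf.prob (replicate_pmf n p) (set_pmf (replicate_pmf n p))"
      by (simp add: measure_pmf.prob_eq_1 AE_measure_pmf_iff)
    also have "\<dots> \<le> measure_pmf.prob (replicate_pmf n p) (A \<union> {x. x \<notin> g (f x)})"
      by (intro measure_pmf.finite_measure_mono) (auto simp: A_def set_replicate_pmf)
    also have "\<dots> \<le> measure_pmf.prob (replicate_pmf n p) A + 1 / 2"
      using measure_Un_le[of A "measure_pmf (replicate_pmf n p)" "{x. x \<notin> g (f x)}"] err
      by (simp add: list_error_def)
    finally have "1 / 2 \<le> measure_pmf.prob (replicate_pmf n p) A"
      by simp
    also have "\<dots> \<le> real (card A) * (2 powr - h) ^ n + \<rho> ^ n"
      unfolding \<rho>_def using \<open>0 < t\<close> by (intro prob_replicate_pmf_le) (auto simp: A_def)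
    also have "real (card A) \<le> 2 powr (real n * (R' + L' * \<kappa>))"
      unfolding A_def \<kappa>_def by (rule list_source_code_hit_card_le[OF code])
    also have "2 powr (real n * (R' + L' * \<kappa>)) \<le> 2 powr (real n * (h - \<eta>))"
    proof -
      have "L' * \<kappa> \<le> (L + \<delta>) * \<kappa>"
        using L' \<open>0 \<le> \<kappa>\<close> by (intro mult_right_mono) auto
      then have "R' + L' * \<kappa> \<le> h - \<eta>"
        using R' \<delta> by (simp add: h_def algebra_simps)
      then show ?thesis
        by (simp add: mult_left_mono)
    qed
    also have "2 powr (real n * (h - \<eta>)) * (2 powr - h) ^ n = (2 powr - \<eta>) ^ n"
      by (simp add: powr_power powr_add[symmetric] algebra_simps)
    finally show False
      using elim by simp
  qed
  then show False
    by simp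
qed

text \<open>The inequality describes a closed half-plane, so it passes from achievable pairs to
  their closure.\<close>

lemma rate_list_region_entropy_le:
  fixes p :: "'a::finite pmf"
  assumes "(R, L) \<in> rate_list_region p"
  shows "source_entropy p \<le> R + L * log 2 (real CARD('a))"
proof -
  have "closed {x :: real \<times> real. source_entropy p \<le> fst x + snd x * log 2 (real CARD('a))}"
    by (intro closed_Collect_le continuous_intros)
  then have "rate_list_region p \<subseteq> {x. source_entropy p \<le> fst x + snd x * log 2 (real CARD('a))}"
    unfolding rate_list_region_def
    by (intro closure_minimal) (auto dest: achievable_imp_entropy_le)
  then show ?thesis
    using assms by auto
qed

section \<open>The syndrome scheme\<close>

lemma CARD_field_gt_1: "1 < CARD('f::{finite,field})"
  using card_mono[of UNIV "{0, 1 :: 'f}"] by simp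

text \<open>The list is the image of a coset under \<open>r\<close>, which may merge
  elements.\<close>

lemma syndrome_decode_card_le:
  fixes H :: "'f::{finite,field} mat"
  assumes "H \<in> carrier_mat l m" "linear_code m k d C" "parity_check_matrix H C"
  shows "card (syndrome_decode H r \<beta> y) \<le> CARD('f) ^ k"
proof -
  let ?S = "{v \<in> carrier_vec m. H *\<^sub>v v = inv_into (carrier_vec (dim_row H)) \<beta> y}"
  have "syndrome_decode H r \<beta> y = r ` ?S"
    using assms(1) by (auto simp: syndrome_decode_def)
  then have "card (syndrome_decode H r \<beta> y) \<le> card ?S"
    using finite_carrier_vec_UNIV[of m, where ?'b = 'f] by (simp add: card_image_le)
  also have "\<dots> \<le> CARD('f) ^ k"
    by (rule syndrome_coset_card_le[OF assms])
  finally show ?thesis .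
qed

text \<open>Each decoded list has at most \<open>CARD('f) ^ k\<close> words, and at least that many
  words of length \<open>n\<close> exist, so it can be padded to the exact size.\<close>

lemma syndrome_scheme_exists:
  fixes H :: "'f::{finite,field} mat" and r :: "'f vec \<Rightarrow> 'a::finite list"
  assumes H: "H \<in> carrier_mat l m" and lin: "linear_code m k d C" and par: "parity_check_matrix H C"
    and lab: "syndrome_labelling l \<beta>" and src: "source_code n m s r"
    and size: "CARD('f) ^ k \<le> CARD('a) ^ n"
  shows "\<exists>f g. syndrome_scheme n k H s r \<beta> f g"
proof -
  let ?Y = "\<beta> ` carrier_vec l"
  have len: "length y = syndrome_bits TYPE('f) l" if "y \<in> ?Y" for y
    using lab that by (auto simp: syndrome_labelling_def)
  \<comment> \<open>Labels share one length, so at most one has index \<open>w\<close>: the union is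
    a single decoded list, or empty if \<open>w\<close> indexes no label.\<close>
  define D where "D w = (\<Union>y\<in>{y\<in>?Y. word_index y = w}. syndrome_decode H r \<beta> y)" for w
  have D_index: "D (word_index y) = syndrome_decode H r \<beta> y" if "y \<in> ?Y" for y
  proof -
    have "{y'\<in>?Y. word_index y' = word_index y} = {y}"
      using that len word_index_inject by fastforce
    then show ?thesis
      by (simp add: D_def)
  qed
  have "\<exists>G. D w \<subseteq> G \<and> G \<subseteq> {xs. length xs = n} \<and> card G = CARD('f) ^ k" for w
  proof (rule exists_subset_between)
    show "card (D w) \<le> CARD('f) ^ k"
    proof (cases "\<exists>y\<in>?Y. word_index y = w")
      case True
      then show ?thesis
        using D_index syndrome_decode_card_le[OF H lin par] by metis
    next
      case False
      then have "D w = {}"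
        by (auto simp: D_def)
      then show ?thesis
        by simp
    qed
    show "CARD('f) ^ k \<le> card {xs :: 'a list. length xs = n}"
      using size card_lists_length_eq[of "UNIV :: 'a set" n] by simp
    show "D w \<subseteq> {xs. length xs = n}"
      using src H by (auto simp: D_def syndrome_decode_def source_code_def)
    show "finite {xs :: 'a list. length xs = n}"
      by (rule finite_length_eq)
  qed
  then obtain G where "\<And>w. D w \<subseteq> G w \<and> G w \<subseteq> {xs. length xs = n} \<and> card (G w) = CARD('f) ^ k"
    by metis
  then have "syndrome_scheme n k H s r \<beta> (\<lambda>x. word_index (syndrome_encode H s \<beta> x)) G"
    using D_index H by (fastforce simp: syndrome_scheme_def)
  then show ?thesis
    by blast
qed

lemma syndrome_scheme_index:
  fixes H :: "'f::{finite,field} mat"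
  assumes "H \<in> carrier_mat l m" "syndrome_labelling l \<beta>" "source_code n m s r"
    and "syndrome_scheme n k H s r \<beta> f g" "length x = n"
  shows "f x \<in> {1..2 ^ syndrome_bits TYPE('f) l}"
proof -
  have "H *\<^sub>v s x \<in> carrier_vec l"
    using assms by (auto simp: source_code_def intro!: mult_mat_vec_carrier)
  then have "length (\<beta> (H *\<^sub>v s x)) = syndrome_bits TYPE('f) l"
    using assms(2) by (auto simp: syndrome_labelling_def)
  from word_index_le[OF this] show ?thesis
    using assms(4,5) by (auto simp: syndrome_scheme_def syndrome_encode_def)
qed

text \<open>The rate is the number of bits per letter, so the number of messages is exactly a power
  of 2; \<open>0 < n\<close> makes the division meaningful.\<close>

lemma syndrome_scheme_list_source_code:
  fixes H :: "'f::{finite,field} mat" and r :: "'f vec \<Rightarrow> 'a::finite list"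
  assumes H: "H \<in> carrier_mat l m" and lab: "syndrome_labelling l \<beta>" and src: "source_code n m s r"
    and sch: "syndrome_scheme n k H s r \<beta> f g" and "0 < n"
    and size: "real CARD('f) ^ k = real CARD('a) powr (real n * L)"
  shows "list_source_code (real (syndrome_bits TYPE('f) l) / real n) L n f g"
  unfolding list_source_code_def
proof (intro exI conjI ballI)
  let ?M = "2 ^ syndrome_bits TYPE('f) l :: nat"
  show "real ?M = 2 powr (real n * (real (syndrome_bits TYPE('f) l) / real n))"
    using \<open>0 < n\<close> by (simp add: powr_realpow)
  show "f \<in> {xs. length xs = n} \<rightarrow> {1..?M}"
    using syndrome_scheme_index[OF H lab src sch] by blast
  have gw: "g w \<subseteq> {xs. length xs = n}" "card (g w) = CARD('f) ^ k" if "w \<in> {1..?M}" for w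
    using sch that H by (auto simp: syndrome_scheme_def)
  show "g \<in> {1..?M} \<rightarrow> Pow {xs. length xs = n} - {{}}"
  proof
    fix w assume w: "w \<in> {1..?M}"
    have "g w \<noteq> {}"
      using gw(2)[OF w] by force
    then show "g w \<in> Pow {xs. length xs = n} - {{}}"
      using gw(1)[OF w] by blast
  qed
  show "real (card (g w)) = real CARD('a) powr (real n * L)" if "w \<in> {1..?M}" for w
    using gw(2)[OF that] size by simp
qed

text \<open>The vector \<open>s x\<close> lies in the coset of its own syndrome, which the injective
  label recovers; hence \<open>r (s x)\<close> is always listed, and the list misses
  \<open>x\<close> only if the source code fails.\<close>

lemma syndrome_scheme_error_le:
  fixes H :: "'f::{finite,field} mat" and r :: "'f vec \<Rightarrow> 'a::finite list"
  assumes H: "H \<in> carrier_mat l m" and lab: "syndrome_labelling l \<beta>" and src: "source_code n m s r"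
    and sch: "syndrome_scheme n k H s r \<beta> f g"
  shows "list_error p n f g \<le> measure_pmf.prob (replicate_pmf n p) {x. r (s x) \<noteq> x}"
proof -
  have hit: "x \<in> g (f x)" if len: "length x = n" and ok: "r (s x) = x" for x
  proof -
    have s: "s x \<in> carrier_vec m"
      using src len by (auto simp: source_code_def)
    then have Hs: "H *\<^sub>v s x \<in> carrier_vec l"
      using H by auto
    have inv: "inv_into (carrier_vec l) \<beta> (\<beta> (H *\<^sub>v s x)) = H *\<^sub>v s x"
      using lab Hs by (simp add: syndrome_labelling_def)
    have "x \<in> syndrome_decode H r \<beta> (\<beta> (H *\<^sub>v s x))"
      unfolding syndrome_decode_def using ok s inv H by force
    moreover have "syndrome_decode H r \<beta> (\<beta> (H *\<^sub>v s x)) \<subseteq> g (word_index (\<beta> (H *\<^sub>v s x)))"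
      using sch Hs H by (auto simp: syndrome_scheme_def)
    moreover have "f x = word_index (\<beta> (H *\<^sub>v s x))"
      using sch len by (simp add: syndrome_scheme_def syndrome_encode_def)
    ultimately show ?thesis
      by auto
  qed
  \<comment> \<open>The scheme constrains only words of length \<open>n\<close>, so the event is cut
    down to the support.\<close>
  have "list_error p n f g =
      measure_pmf.prob (replicate_pmf n p) ({x. x \<notin> g (f x)} \<inter> set_pmf (replicate_pmf n p))"
    by (simp add: list_error_def measure_Int_set_pmf)
  also have "\<dots> \<le> measure_pmf.prob (replicate_pmf n p) {x. r (s x) \<noteq> x}"
    using hit by (intro measure_pmf.finite_measure_mono) (auto simp: set_replicate_pmf)
  finally show ?thesis .
qed

text \<open>The existence part keeps the second part from being vacuous; the latter covers every way
  of filling up the lists.\<close>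

theorem proposition2:
  fixes p :: "'a::finite pmf"
    and L :: real
    and Ln :: "nat \<Rightarrow> real"
    and m k d :: "nat \<Rightarrow> nat"
    and s :: "nat \<Rightarrow> 'a list \<Rightarrow> 'f::{finite,field} vec"
    and r :: "nat \<Rightarrow> 'f vec \<Rightarrow> 'a list"
    and C :: "nat \<Rightarrow> 'f vec set"
    and H :: "nat \<Rightarrow> 'f mat"
    and \<beta> :: "nat \<Rightarrow> 'f vec \<Rightarrow> bool list"
  assumes "0 \<le> L" and "L \<le> 1"
    and "\<And>n. 0 < n \<Longrightarrow> source_code n (m n) (s n) (r n)"
    and "\<And>n. 0 < n \<Longrightarrow>
           real (k n) = real n * Ln n * log 2 (real CARD('a)) / log 2 (real CARD('f))"
    and "\<And>n. 0 < n \<Longrightarrow> 0 \<le> Ln n \<and> Ln n \<le> 1"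
    and "Ln \<longlonglongrightarrow> L"
    and "\<And>n. 0 < n \<Longrightarrow> linear_code (m n) (k n) (d n) (C n)"
    and "\<And>n. 0 < n \<Longrightarrow> H n \<in> carrier_mat (m n - k n) (m n)"
    and "\<And>n. 0 < n \<Longrightarrow> parity_check_matrix (H n) (C n)"
    and "\<And>n. 0 < n \<Longrightarrow> syndrome_labelling (m n - k n) (\<beta> n)"
    and "asymptotically_optimal p m s r"
  shows "(\<forall>n>0. \<exists>f g. syndrome_scheme n (k n) (H n) (s n) (r n) (\<beta> n) f g) \<and>
         (\<forall>f g. (\<forall>n>0. syndrome_scheme n (k n) (H n) (s n) (r n) (\<beta> n) (f n) (g n)) \<longrightarrow>
                achieves p (\<lambda>n. real (syndrome_bits TYPE('f) (m n - k n)) / real n) Ln f g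
                  (rate_list_function p L) L)"
proof -
  let ?q = "log 2 (real CARD('f))" and ?a = "log 2 (real CARD('a))"
  let ?b = "\<lambda>n. real (syndrome_bits TYPE('f) (m n - k n)) / real n"
  note src = assms(3) and kn = assms(4) and Ln01 = assms(5) and Ln = assms(6) and lin = assms(7)
    and H = assms(8) and par = assms(9) and lab = assms(10) and opt = assms(11)
  have q: "0 < ?q"
    using CARD_field_gt_1[where ?'f = 'f] by simp
  \<comment> \<open>The formula for \<open>k n\<close> says that both sides have the same
    logarithm.\<close>
  have size: "real CARD('f) ^ k n = real CARD('a) powr (real n * Ln n)" if "0 < n" for n
  proof -
    have "real CARD('f) ^ k n = 2 powr (?q * real (k n))"
      using CARD_field_gt_1[where ?'f = 'f] by (simp add: powr_powr[symmetric] powr_realpow)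
    also have "?q * real (k n) = ?a * (real n * Ln n)"
      unfolding kn[OF that] times_divide_eq_right
        nonzero_mult_div_cancel_left[OF less_imp_neq[OF q, symmetric]]
      by (simp only: ac_simps)
    also have "2 powr \<dots> = real CARD('a) powr (real n * Ln n)"
      by (simp add: powr_powr[symmetric])
    finally show ?thesis .
  qed
  have exists_scheme: "\<exists>f g. syndrome_scheme n (k n) (H n) (s n) (r n) (\<beta> n) f g" if n: "0 < n" for n
  proof -
    \<comment> \<open>Here \<open>Ln n \<le> 1\<close> ensures that there are enough words to fill a
      list.\<close>
    have "real CARD('f) ^ k n \<le> real CARD('a) powr real n"
      using Ln01[OF n] unfolding size[OF n]
      by (intro powr_mono) (auto simp: Suc_leI mult_left_le)
    then have "real (CARD('f) ^ k n) \<le> real (CARD('a) ^ n)"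
      by (simp add: powr_realpow)
    then have "CARD('f) ^ k n \<le> CARD('a) ^ n"
      by (simp only: of_nat_le_iff)
    then show ?thesis
      by (rule syndrome_scheme_exists[OF H[OF n] lin[OF n] par[OF n] lab[OF n] src[OF n]])
  qed
  define R0 where "R0 = source_entropy p - L * ?a"
  \<comment> \<open>Rounding up to whole bits costs at most one bit per block, so the rate lies
    within \<open>1 / real n\<close> above \<open>?c n\<close>, the unrounded rate.\<close>
  have rate: "?b \<longlonglongrightarrow> R0"
  proof (rule tendsto_sandwich)
    let ?c = "\<lambda>n. real (m n) / real n * ?q - Ln n * ?a"
    have c: "?c n = real (m n - k n) * ?q / real n" if "0 < n" for n
      using kn[OF that] q linear_code_dim_le[OF lin[OF that]] that
      by (simp add: of_nat_diff field_simps)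
    have bits: "real (syndrome_bits TYPE('f) l) = of_int \<lceil>real l * ?q\<rceil>" for l
      using q by (simp add: syndrome_bits_def)
    show "\<forall>\<^sub>F n in sequentially. ?c n \<le> ?b n"
      using eventually_gt_at_top[of 0]
    proof eventually_elim
      case (elim n)
      show ?case
        unfolding c[OF elim] bits by (intro divide_right_mono le_of_int_ceiling) simp
    qed
    show "\<forall>\<^sub>F n in sequentially. ?b n \<le> ?c n + 1 / real n"
      using eventually_gt_at_top[of 0]
    proof eventually_elim
      case (elim n)
      have "?b n \<le> (real (m n - k n) * ?q + 1) / real n"
        unfolding bits by (intro divide_right_mono) linarith+
      then show ?case
        unfolding c[OF elim] add_divide_distrib .
    qed
    have "?c \<longlonglongrightarrow> source_entropy p / ?q * ?q - L * ?a"
      using opt Ln unfolding asymptotically_optimal_def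
      by (intro tendsto_diff tendsto_mult tendsto_const) blast+
    moreover have "source_entropy p / ?q * ?q = source_entropy p"
      by (rule nonzero_eq_divide_eq[OF less_imp_neq[OF q, symmetric], THEN iffD1, OF refl])
    ultimately show lim: "?c \<longlonglongrightarrow> R0"
      by (simp only: R0_def)
    show "(\<lambda>n. ?c n + 1 / real n) \<longlonglongrightarrow> R0"
      using tendsto_add[OF lim lim_1_over_n] by simp
  qed
  \<comment> \<open>Rates are only bounded from above, so any \<open>R\<close> from
    \<open>R0\<close> on is allowed. This is used for \<open>R0\<close> itself, to place it in the
    region, and then for the rate list function.\<close>
  have achieves_R: "achieves p ?b Ln f g R L"
    if sch: "\<forall>n>0. syndrome_scheme n (k n) (H n) (s n) (r n) (\<beta> n) (f n) (g n)" and "R0 \<le> R"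
    for f g R
    unfolding achieves_def
  proof (intro allI impI)
    fix \<delta> \<epsilon> :: real
    assume "0 < \<delta>" and \<epsilon>: "0 < \<epsilon> \<and> \<epsilon> < 1"
    have "\<forall>\<^sub>F n in sequentially. ?b n < R + \<delta>"
      using order_tendstoD(2)[OF rate] \<open>R0 \<le> R\<close> \<open>0 < \<delta>\<close> by simp
    moreover have "\<forall>\<^sub>F n in sequentially. \<bar>Ln n - L\<bar> < \<delta>"
      using tendstoD[OF Ln \<open>0 < \<delta>\<close>] by (simp add: dist_real_def)
    moreover have "\<forall>\<^sub>F n in sequentially. measure_pmf.prob (replicate_pmf n p) {x. r n (s n x) \<noteq> x} < \<epsilon>"
      using opt \<epsilon> by (auto simp: asymptotically_optimal_def intro: order_tendstoD(2))
    ultimately show "\<forall>\<^sub>F n in sequentially. meets_tolerance p R L \<delta> \<epsilon> n (?b n) (Ln n) (f n) (g n)"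
      using eventually_gt_at_top[of 0]
    proof eventually_elim
      case (elim n)
      note n = elim(4)
      have sch_n: "syndrome_scheme n (k n) (H n) (s n) (r n) (\<beta> n) (f n) (g n)"
        using sch n by blast
      have "list_source_code (?b n) (Ln n) n (f n) (g n)"
        by (rule syndrome_scheme_list_source_code[OF H[OF n] lab[OF n] src[OF n] sch_n n size[OF n]])
      moreover have "list_error p n (f n) (g n) \<le> \<epsilon>"
        using syndrome_scheme_error_le[OF H[OF n] lab[OF n] src[OF n] sch_n] elim(3)
        by (rule order_trans[OF _ less_imp_le])
      ultimately show ?case
        using elim(1,2) by (simp only: meets_tolerance_def)
    qed
  qed
  obtain f0 g0 where "\<forall>n>0. syndrome_scheme n (k n) (H n) (s n) (r n) (\<beta> n) (f0 n) (g0 n)"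
    using exists_scheme by metis
  from achieves_R[OF this order_refl] have "achievable p R0 L"
    unfolding achieves_def achievable_def by (elim all_forward imp_forward eventually_mono) blast+
  then have R0: "(R0, L) \<in> rate_list_region p"
    unfolding rate_list_region_def by (intro closure_subset[THEN subsetD]) simp
  \<comment> \<open>The converse bounds every rate in the set below by \<open>R0\<close>; membership
    of \<open>R0\<close> shows that the set is nonempty, as the infimum over the reals
    requires.\<close>
  have "R0 \<le> rate_list_function p L"
    unfolding rate_list_function_def
  proof (rule cInf_greatest)
    show "{R. (R, L) \<in> rate_list_region p} \<noteq> {}"
      using R0 by blast
    show "R0 \<le> R" if "R \<in> {R. (R, L) \<in> rate_list_region p}" for R
      using rate_list_region_entropy_le[of R L p] that by (simp add: R0_def)
  qed
  show ?thesis
  proof (intro conjI allI impI)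
    show "\<exists>f g. syndrome_scheme n (k n) (H n) (s n) (r n) (\<beta> n) f g" if "0 < n" for n
      using that by (rule exists_scheme)
    show "achieves p ?b Ln f g (rate_list_function p L) L"
      if "\<forall>n>0. syndrome_scheme n (k n) (H n) (s n) (r n) (\<beta> n) (f n) (g n)" for f g
      using that \<open>R0 \<le> rate_list_function p L\<close> by (rule achieves_R)
  qed
qed

end
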